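(* For every finite simple graph $H$ and every integer $r\geq 2$, the compatibility graph $C_{\mathrm{Hom}_p(\mathcal{K}_r, H)}$ is $\mathcal{K}_{r+1}$-free, i.e. it contains no clique on $r+1$ vertices.
   Context: All graphs are finite, simple and undirected; $\mathcal{K}_r$ denotes the complete graph on vertex set $\{1,\dots,r\}$. For a graph $H$, the Hom poset $\mathrm{Hom}_p(\mathcal{K}_r,H)$ is the set of all $r$-tuples $(A_1,\dots,A_r)$ of non-empty subsets of $V(H)$ such that for every pair $i\neq j$ in $\{1,\dots,r\}$ every vertex of $A_i$ is adjacent in $H$ to every vertex of $A_j$ (i.e. $A_i\times A_j\subseteq E(H)$), ordered by $(A_1,\dots,A_r)\leq(B_1,\dots,B_r)$ iff $A_i\subseteq B_i$ for all $i$. The cyclic group $Z_r=\{e=\omega^0,\omega,\dots,\omega^{r-1}\}$ acts on it by cyclic shift: $\omega^i.(A_1,\dots,A_r)=(A_{1+i},\dots,A_{r+i})$, indices taken modulo $r$ in $\{1,\dots,r\}$. For a poset $P$ with an order-preserving action of a finite group $G$, the compatibility graph $C_P$ has vertex set $P$, with $x,y$ adjacent iff there is $g\in G\setminus\{e\}$ such that $x$ and $g.y$ are comparable in $P$. A graph is $\mathcal{K}_{r+1}$-free if no induced subgraph is isomorphic to $\mathcal{K}_{r+1}$. *)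

theory Defs
  imports
    "Graph_Theory.Graph_Theory"
    "HOL-Algebra.Order"
    "HOL-Algebra.Group_Action"
    "HOL-Algebra.Elementary_Groups"
begin

text \<open>
  Finite simple undirected graphs are the loop-free symmetric digraphs of the locale
  \<^locale>\<open>pair_graph\<close>: an edge between \<open>u\<close> and \<open>v\<close> is the pair of arcs \<open>(u, v)\<close>, \<open>(v, u)\<close>.
\<close>

definition complete_graph :: "nat \<Rightarrow> nat pair_pre_digraph" where
  "complete_graph n = \<lparr> pverts = {1..n}, parcs = {(i, j). i \<in> {1..n} \<and> j \<in> {1..n} \<and> i \<noteq> j} \<rparr>"

definition complete_graph_free :: "nat \<Rightarrow> 'a pair_pre_digraph \<Rightarrow> bool" where
  "complete_graph_free n G \<longleftrightarrow>
     \<not> (\<exists>S. induced_subgraph S (with_proj G) \<and> digraph_iso S (with_proj (complete_graph n)))"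

text \<open>
  An \<open>r\<close>-tuple is an extensional function on \<open>{1..r}\<close>, so that equality of tuples is equality of
  functions.
\<close>

definition hom_poset :: "nat \<Rightarrow> 'a pair_pre_digraph \<Rightarrow> (nat \<Rightarrow> 'a set) gorder" where
  "hom_poset r H =
     \<lparr> carrier = {A \<in> {1..r} \<rightarrow>\<^sub>E {X. X \<subseteq> pverts H \<and> X \<noteq> {}}.
          \<forall>i\<in>{1..r}. \<forall>j\<in>{1..r}. i \<noteq> j \<longrightarrow> A i \<times> A j \<subseteq> parcs H},
       eq = (=),
       le = (\<lambda>A B. \<forall>i\<in>{1..r}. A i \<subseteq> B i) \<rparr>"

text \<open>
  The group \<open>Z\<^sub>r\<close> is \<^term>\<open>integer_mod_group r\<close>, written additively on \<open>{0..<r}\<close>: the integer \<open>k\<close>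
  stands for the \<open>k\<close>-th power of the generator. \<open>shift_index r k i\<close> is \<open>i + k\<close> reduced modulo \<open>r\<close>
  into \<open>{1..r}\<close> (not into \<open>{0..<r}\<close>).
\<close>

definition shift_index :: "nat \<Rightarrow> int \<Rightarrow> nat \<Rightarrow> nat" where
  "shift_index r k i = nat ((int i + k - 1) mod int r) + 1"

definition cyclic_action :: "nat \<Rightarrow> 'a pair_pre_digraph \<Rightarrow> int \<Rightarrow> (nat \<Rightarrow> 'a set) \<Rightarrow> nat \<Rightarrow> 'a set" where
  "cyclic_action r H k = (\<lambda>A\<in>carrier (hom_poset r H). \<lambda>i\<in>{1..r}. A (shift_index r k i))"

text \<open>
  For an arbitrary action the following graph may have loops; it is simple for the action above, see
  \<open>pair_graph_compatibility_graph_hom_poset\<close> below.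
\<close>

definition compatibility_graph ::
    "('g, 'm) monoid_scheme \<Rightarrow> ('p, 'o) gorder_scheme \<Rightarrow> ('g \<Rightarrow> 'p \<Rightarrow> 'p) \<Rightarrow> 'p pair_pre_digraph" where
  "compatibility_graph G P \<phi> =
     \<lparr> pverts = carrier P,
       parcs = {(x, y). x \<in> carrier P \<and> y \<in> carrier P \<and>
         (\<exists>g \<in> carrier G - {\<one>\<^bsub>G\<^esub>}. x \<sqsubseteq>\<^bsub>P\<^esub> \<phi> g y \<or> \<phi> g y \<sqsubseteq>\<^bsub>P\<^esub> x)} \<rparr>"

lemma partial_order_hom_poset: "partial_order (hom_poset r H)"
  by unfold_locales (auto simp: hom_poset_def PiE_eq_iff, (blast intro: PiE_ext)+)

lemma shift_index_in: "i \<in> {1..r} \<Longrightarrow> shift_index r k i \<in> {1..r}"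
  by (auto simp: shift_index_def nat_less_iff Suc_le_eq)

lemma shift_index_add:
  assumes "i \<in> {1..r}"
  shows "shift_index r l (shift_index r k i) = shift_index r ((k + l) mod int r) i"
proof -
  have "int (nat ((int i + k - 1) mod int r) + 1) + l - 1 = (int i + k - 1) mod int r + l"
    using assms by simp
  moreover have "((int i + k - 1) mod int r + l) mod int r
      = (int i + (k + l) mod int r - 1) mod int r"
    using mod_add_right_eq[of "int i - 1" "k + l" "int r"] by (simp add: mod_simps algebra_simps)
  ultimately show ?thesis
    unfolding shift_index_def by presburger
qed

lemma shift_index_0: "i \<in> {1..r} \<Longrightarrow> shift_index r 0 i = i"
  by (auto simp: shift_index_def nat_diff_distrib)

lemma shift_index_neq:
  assumes "i \<in> {1..r}" "0 < k" "k < int r"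
  shows "shift_index r k i \<noteq> i"
proof
  assume "shift_index r k i = i"
  then have "(int i + k - 1) mod int r = int i - 1"
    using assms pos_mod_sign[of "int r" "int i + k - 1"] unfolding shift_index_def by linarith
  then have "(int i + k - 1) mod int r = (int i - 1) mod int r"
    using assms(1) by auto
  then have "int r dvd k"
    by (metis add_diff_cancel_left' add_diff_eq diff_add_eq mod_eq_dvd_iff)
  then show False
    using assms(2,3) zdvd_not_zless by blast
qed

lemma shift_index_inj:
  assumes "i \<in> {1..r}" "j \<in> {1..r}" "shift_index r k i = shift_index r k j"
  shows "i = j"
proof -
  have "shift_index r ((k + - k) mod int r) i = shift_index r ((k + - k) mod int r) j"
    using assms by (metis shift_index_add)
  then show ?thesis using assms by (simp add: shift_index_0)
qed

lemma cyclic_action_apply: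
  "A \<in> carrier (hom_poset r H) \<Longrightarrow> i \<in> {1..r} \<Longrightarrow> cyclic_action r H k A i = A (shift_index r k i)"
  by (simp add: cyclic_action_def)

lemma in_hom_poset_iff:
  "A \<in> carrier (hom_poset r H) \<longleftrightarrow>
     A \<in> extensional {1..r} \<and> (\<forall>i\<in>{1..r}. A i \<subseteq> pverts H \<and> A i \<noteq> {}) \<and>
     (\<forall>i\<in>{1..r}. \<forall>j\<in>{1..r}. i \<noteq> j \<longrightarrow> A i \<times> A j \<subseteq> parcs H)"
  by (auto simp: hom_poset_def PiE_iff simp del: atLeastAtMost_iff)

lemma le_hom_poset_iff: "A \<sqsubseteq>\<^bsub>hom_poset r H\<^esub> B \<longleftrightarrow> (\<forall>i\<in>{1..r}. A i \<subseteq> B i)"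
  by (simp add: hom_poset_def)

lemma cyclic_action_closed:
  assumes A: "A \<in> carrier (hom_poset r H)"
  shows "cyclic_action r H k A \<in> carrier (hom_poset r H)"
proof -
  have "cyclic_action r H k A \<in> extensional {1..r}"
    using A by (simp add: cyclic_action_def)
  moreover have "cyclic_action r H k A i \<subseteq> pverts H \<and> cyclic_action r H k A i \<noteq> {}"
    if "i \<in> {1..r}" for i
    using A shift_index_in[OF that, of k] that
    by (simp add: cyclic_action_apply in_hom_poset_iff del: atLeastAtMost_iff)
  moreover have "cyclic_action r H k A i \<times> cyclic_action r H k A j \<subseteq> parcs H"
    if ij: "i \<in> {1..r}" "j \<in> {1..r}" "i \<noteq> j" for i j
  proof -
    have "shift_index r k i \<noteq> shift_index r k j" using shift_index_inj ij by blast
    then have "A (shift_index r k i) \<times> A (shift_index r k j) \<subseteq> parcs H"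
      using A shift_index_in[OF ij(1), of k] shift_index_in[OF ij(2), of k]
      unfolding in_hom_poset_iff by blast
    then show ?thesis using A ij by (simp only: cyclic_action_apply)
  qed
  ultimately show ?thesis unfolding in_hom_poset_iff by blast
qed

lemma cyclic_action_mono:
  assumes "A \<in> carrier (hom_poset r H)" "B \<in> carrier (hom_poset r H)" "A \<sqsubseteq>\<^bsub>hom_poset r H\<^esub> B"
  shows "cyclic_action r H k A \<sqsubseteq>\<^bsub>hom_poset r H\<^esub> cyclic_action r H k B"
proof -
  have "\<forall>i\<in>{1..r}. A i \<subseteq> B i" using assms(3) by (simp add: hom_poset_def)
  then have "\<forall>i\<in>{1..r}. cyclic_action r H k A i \<subseteq> cyclic_action r H k B i"
    using assms(1,2) shift_index_in[of _ r k] by (metis cyclic_action_apply)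
  then show ?thesis by (simp add: hom_poset_def)
qed

lemma cyclic_action_add:
  assumes A: "A \<in> carrier (hom_poset r H)"
  shows "cyclic_action r H k (cyclic_action r H l A) = cyclic_action r H ((k + l) mod int r) A"
proof (rule extensionalityI[of _ "{1..r}"])
  show "cyclic_action r H k (cyclic_action r H l A) \<in> extensional {1..r}"
    using cyclic_action_closed[OF cyclic_action_closed[OF A]] in_hom_poset_iff by blast
  show "cyclic_action r H ((k + l) mod int r) A \<in> extensional {1..r}"
    using cyclic_action_closed[OF A] in_hom_poset_iff by blast
next
  fix i assume i: "i \<in> {1..r}"
  show "cyclic_action r H k (cyclic_action r H l A) i = cyclic_action r H ((k + l) mod int r) A i"
    by (simp only: cyclic_action_apply[OF cyclic_action_closed[OF A] i]
        cyclic_action_apply[OF A shift_index_in[OF i]] cyclic_action_apply[OF A i]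
        shift_index_add[OF i])
qed

lemma cyclic_action_0:
  assumes A: "A \<in> carrier (hom_poset r H)"
  shows "cyclic_action r H 0 A = A"
proof (rule extensionalityI[of _ "{1..r}"])
  show "cyclic_action r H 0 A \<in> extensional {1..r}" "A \<in> extensional {1..r}"
    using A cyclic_action_closed[OF A] in_hom_poset_iff by blast+
qed (simp only: cyclic_action_apply[OF A] shift_index_0)

lemma group_action_cyclic_action:
  "group_action (integer_mod_group r) (carrier (hom_poset r H)) (cyclic_action r H)"
proof -
  let ?E = "carrier (hom_poset r H)"
  have bij: "cyclic_action r H k \<in> Bij ?E" for k
  proof -
    have "bij_betw (cyclic_action r H k) ?E ?E"
      by (rule bij_betw_byWitness[where f' = "cyclic_action r H (- k)"])
        (auto simp: cyclic_action_add cyclic_action_0 cyclic_action_closed)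
    then show ?thesis by (simp add: Bij_def cyclic_action_def)
  qed
  have "cyclic_action r H ((k + l) mod int r)
      = compose ?E (cyclic_action r H k) (cyclic_action r H l)" for k l
  proof (rule ext)
    fix A
    show "cyclic_action r H ((k + l) mod int r) A
        = compose ?E (cyclic_action r H k) (cyclic_action r H l) A"
      by (cases "A \<in> ?E") (simp_all add: compose_def cyclic_action_add, simp add: cyclic_action_def)
  qed
  then have "cyclic_action r H \<in> hom (integer_mod_group r) (BijGroup ?E)"
    by (intro homI) (simp_all add: bij BijGroup_def)
  then show ?thesis
    by (simp add: group_action_def group_hom_def group_hom_axioms_def group_BijGroup)
qed

lemma finite_carrier_hom_poset:
  assumes "finite (pverts H)"
  shows "finite (carrier (hom_poset r H))"
proof (rule finite_subset)
  show "carrier (hom_poset r H) \<subseteq> {1..r} \<rightarrow>\<^sub>E Pow (pverts H)"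
    by (rule subsetI, unfold in_hom_poset_iff PiE_iff) blast
  show "finite ({1..r} \<rightarrow>\<^sub>E Pow (pverts H))"
    using assms by (intro finite_PiE) auto
qed

lemma pair_graph_compatibility_graph_hom_poset:
  assumes "pair_graph H" "r \<ge> 2"
  shows "pair_graph
    (compatibility_graph (integer_mod_group r) (hom_poset r H) (cyclic_action r H))"
    (is "pair_graph ?C")
proof -
  interpret H: pair_graph H by fact
  let ?P = "hom_poset r H" and ?\<phi> = "cyclic_action r H"
  have arc: "(x, y) \<in> parcs ?C \<longleftrightarrow> x \<in> carrier ?P \<and> y \<in> carrier ?P \<and>
      (\<exists>k. 0 < k \<and> k < int r \<and> (x \<sqsubseteq>\<^bsub>?P\<^esub> ?\<phi> k y \<or> ?\<phi> k y \<sqsubseteq>\<^bsub>?P\<^esub> x))" for x y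
    using assms(2) by (force simp: compatibility_graph_def carrier_integer_mod_group)
  have fin: "finite (carrier ?P)"
    using finite_carrier_hom_poset H.finite_verts by blast
  have sym: "(y, x) \<in> parcs ?C" if "(x, y) \<in> parcs ?C" for x y
  proof -
    obtain k where k: "0 < k" "k < int r" "x \<sqsubseteq>\<^bsub>?P\<^esub> ?\<phi> k y \<or> ?\<phi> k y \<sqsubseteq>\<^bsub>?P\<^esub> x"
      and xy: "x \<in> carrier ?P" "y \<in> carrier ?P"
      using \<open>(x, y) \<in> parcs ?C\<close> arc by blast
    have "?\<phi> (int r - k) (?\<phi> k y) = y"
      using xy by (simp add: cyclic_action_add cyclic_action_0)
    then have "y \<sqsubseteq>\<^bsub>?P\<^esub> ?\<phi> (int r - k) x \<or> ?\<phi> (int r - k) x \<sqsubseteq>\<^bsub>?P\<^esub> y"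
      using k(3) xy cyclic_action_mono cyclic_action_closed by metis
    then show ?thesis
      using k(1,2) xy arc by (intro arc[THEN iffD2] conjI exI[of _ "int r - k"]) auto
  qed
  have irrefl: "(x, x) \<notin> parcs ?C" for x
  proof
    assume "(x, x) \<in> parcs ?C"
    then obtain k where k: "0 < k" "k < int r" "x \<sqsubseteq>\<^bsub>?P\<^esub> ?\<phi> k x \<or> ?\<phi> k x \<sqsubseteq>\<^bsub>?P\<^esub> x"
      and x: "x \<in> carrier ?P"
      using arc by blast
    let ?j = "shift_index r k 1"
    have 1: "1 \<in> {1..r}" using assms(2) by simp
    note j = shift_index_in[OF 1, of k] shift_index_neq[OF 1 k(1,2)]
    have "x 1 \<subseteq> x ?j \<or> x ?j \<subseteq> x 1"
      using k(3) 1 unfolding le_hom_poset_iff by (metis cyclic_action_apply[OF x 1])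
    moreover have "x 1 \<noteq> {}" "x ?j \<noteq> {}"
      using x 1 j(1) unfolding in_hom_poset_iff by blast+
    moreover have "x 1 \<times> x ?j \<subseteq> parcs H"
      using x 1 j unfolding in_hom_poset_iff by metis
    ultimately obtain v where "(v, v) \<in> parcs H" by blast
    then show False using H.no_loops' by blast
  qed
  have "parcs ?C \<subseteq> carrier ?P \<times> carrier ?P" "pverts ?C = carrier ?P"
    by (auto simp: compatibility_graph_def)
  then show ?thesis
    using fin sym irrefl finite_subset[OF _ finite_cartesian_product[OF fin fin]]
    by unfold_locales (auto simp: symmetric_def intro!: symI)
qed

lemma complete_graph_free_iff_no_clique:
  assumes "pair_graph G"
  shows "complete_graph_free n G \<longleftrightarrow>
    \<not> (\<exists>S \<subseteq> pverts G. card S = n \<and> finite S \<and> (\<forall>u\<in>S. \<forall>v\<in>S. u \<noteq> v \<longrightarrow> (u, v) \<in> parcs G))"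
    (is "_ \<longleftrightarrow> \<not> ?clique")
proof -
  interpret G: pair_graph G by fact
  let ?K = "with_proj (complete_graph n)"
  have "?clique" if S: "induced_subgraph S (with_proj G)" "digraph_iso S ?K" for S
  proof -
    obtain f where f: "pre_digraph.digraph_isomorphism S f" "?K = app_iso f S"
      using S(2) by (auto simp: digraph_iso_def)
    have v: "iso_verts f ` verts S = {1..n}"
      and a: "iso_arcs f ` arcs S = {(i, j). i \<in> {1..n} \<and> j \<in> {1..n} \<and> i \<noteq> j}"
      and th: "iso_tail f = fst" "iso_head f = snd"
      using arg_cong[OF f(2), of verts] arg_cong[OF f(2), of arcs]
        arg_cong[OF f(2), of tail] arg_cong[OF f(2), of head]
      by (simp_all add: complete_graph_def with_proj_def)
    have inj: "inj_on (iso_verts f) (verts S)"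
      and ends: "\<And>e. e \<in> arcs S \<Longrightarrow>
        iso_verts f (tail S e) = fst (iso_arcs f e) \<and> iso_verts f (head S e) = snd (iso_arcs f e)"
      and wf: "wf_digraph S"
      using f(1) th by (auto simp: pre_digraph.digraph_isomorphism_def)
    have sub: "verts S \<subseteq> pverts G" "arcs S \<subseteq> parcs G" "tail S = fst" "head S = snd"
      using S(1) by (auto simp: induced_subgraph_def subgraph_def compatible_def)
    have "card (verts S) = n" using card_image[OF inj] v by simp
    moreover have "finite (verts S)" using inj v by (metis finite_atLeastAtMost finite_image_iff)
    moreover have "(u, w) \<in> parcs G" if uw: "u \<in> verts S" "w \<in> verts S" "u \<noteq> w" for u w
    proof -
      have "iso_verts f u \<noteq> iso_verts f w" using inj uw by (meson inj_onD)
      then have "(iso_verts f u, iso_verts f w) \<in> iso_arcs f ` arcs S"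
        using uw v unfolding a by blast
      then obtain e where e: "e \<in> arcs S" "iso_arcs f e = (iso_verts f u, iso_verts f w)"
        by (metis imageE)
      then have "iso_verts f (fst e) = iso_verts f u" "iso_verts f (snd e) = iso_verts f w"
        using ends[OF e(1)] e(2) sub(3,4) by auto
      moreover have "fst e \<in> verts S" "snd e \<in> verts S"
        using wf e(1) sub(3,4) by (metis wf_digraph.tail_in_verts wf_digraph.head_in_verts)+
      ultimately have "e = (u, w)" using inj uw by (metis inj_onD prod.collapse)
      then show ?thesis using e sub by blast
    qed
    ultimately show ?thesis using sub(1) by blast
  qed
  moreover have "\<exists>S. induced_subgraph S (with_proj G) \<and> digraph_iso S ?K" if ?clique
  proof -
    obtain S where S: "S \<subseteq> pverts G" "card S = n" "finite S"
      "\<forall>u\<in>S. \<forall>v\<in>S. u \<noteq> v \<longrightarrow> (u, v) \<in> parcs G"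
      using \<open>?clique\<close> by blast
    let ?A = "{(u, v). u \<in> S \<and> v \<in> S \<and> u \<noteq> v}"
    let ?S = "with_proj \<lparr> pverts = S, parcs = ?A \<rparr>"
    obtain h where h: "bij_betw h S {1..n}"
      using S(2,3) by (metis card_atLeastAtMost diff_Suc_1 finite_atLeastAtMost finite_same_card_bij)
    let ?f = "\<lparr> iso_verts = h, iso_arcs = map_prod h h, iso_head = snd, iso_tail = fst \<rparr>"
    have wf: "wf_digraph ?S" by unfold_locales auto
    have "induced_subgraph ?S (with_proj G)"
      using S wf G.wf_digraph
      by (auto simp: induced_subgraph_def subgraph_def compatible_def dest: G.no_loops')
    moreover have "inj_on h S" using h by (simp add: bij_betw_def)
    then have "pre_digraph.digraph_isomorphism ?S ?f"
      using wf by (auto simp: pre_digraph.digraph_isomorphism_def inj_on_def)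
    moreover have "map_prod h h ` ?A = {(i, j). i \<in> {1..n} \<and> j \<in> {1..n} \<and> i \<noteq> j}"
    proof (intro equalityI subsetI)
      fix p assume "p \<in> map_prod h h ` ?A"
      then obtain u v where uv: "u \<in> S" "v \<in> S" "u \<noteq> v" "p = (h u, h v)" by auto
      then have "h u \<noteq> h v" using \<open>inj_on h S\<close> by (meson inj_onD)
      then show "p \<in> {(i, j). i \<in> {1..n} \<and> j \<in> {1..n} \<and> i \<noteq> j}"
        using uv bij_betw_apply[OF h] by blast
    next
      fix p assume "p \<in> {(i, j). i \<in> {1..n} \<and> j \<in> {1..n} \<and> i \<noteq> j}"
      then obtain i j where ij: "p = (i, j)" "i \<in> h ` S" "j \<in> h ` S" "i \<noteq> j"
        using h unfolding bij_betw_def by blast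
      then obtain u v where "u \<in> S" "v \<in> S" "i = h u" "j = h v" by blast
      then show "p \<in> map_prod h h ` ?A"
        using ij by (intro image_eqI[of _ _ "(u, v)"]) auto
    qed
    then have "?K = app_iso ?f ?S"
      using h by (simp add: app_iso_def complete_graph_def with_proj_def bij_betw_def)
    ultimately show ?thesis unfolding digraph_iso_def by blast
  qed
  ultimately show ?thesis unfolding complete_graph_free_def by blast
qed

end

theory Submission
  imports Defs
begin

text \<open>
  Two distinct translates of a tuple \<open>y\<close> have no common lower bound, as distinct entries of \<open>y\<close> are
  disjoint. Being below some translate is a total preorder on a clique \<open>S\<close>, so \<open>S\<close> has an element
  \<open>m\<close> below a translate \<open>h y \<cdot> y\<close> of each \<open>y \<in> S\<close>. If \<open>h x = h y\<close> and \<open>x \<le> g \<cdot> y\<close>, then \<open>m\<close> is below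
  both \<open>h y \<cdot> y\<close> and \<open>(h y + g) \<cdot> y\<close>, so \<open>g\<close> is trivial. Hence \<open>h\<close> is injective from \<open>S\<close> to \<open>Z\<^sub>r\<close>.
\<close>

lemma hom_poset_le_trans:
  "A \<sqsubseteq>\<^bsub>hom_poset r H\<^esub> B \<Longrightarrow> B \<sqsubseteq>\<^bsub>hom_poset r H\<^esub> C \<Longrightarrow> A \<sqsubseteq>\<^bsub>hom_poset r H\<^esub> C"
  unfolding le_hom_poset_iff by blast

text \<open>Shifting by \<open>k\<close> is monotone, so it turns the second inequality into one
  that starts at \<open>cyclic_action r H k y\<close>, and the two shifts add up modulo
  \<open>r\<close>. The conclusion names the resulting shift because the injectivity argument
  compares shifts.\<close>

lemma le_cyclic_action_trans:
  assumes "y \<in> carrier (hom_poset r H)" "z \<in> carrier (hom_poset r H)"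
    and "x \<sqsubseteq>\<^bsub>hom_poset r H\<^esub> cyclic_action r H k y" "y \<sqsubseteq>\<^bsub>hom_poset r H\<^esub> cyclic_action r H l z"
  shows "x \<sqsubseteq>\<^bsub>hom_poset r H\<^esub> cyclic_action r H ((k + l) mod int r) z"
  using hom_poset_le_trans[OF assms(3) cyclic_action_mono[OF assms(1) _ assms(4)]]
  by (simp add: assms(2) cyclic_action_closed cyclic_action_add)

lemma le_cyclic_action_unique:
  assumes H: "pair_graph H"
    and x: "x \<in> carrier (hom_poset r H)" and y: "y \<in> carrier (hom_poset r H)"
    and k: "k \<in> {0..<int r}" and l: "l \<in> {0..<int r}"
    and le: "x \<sqsubseteq>\<^bsub>hom_poset r H\<^esub> cyclic_action r H k y" "x \<sqsubseteq>\<^bsub>hom_poset r H\<^esub> cyclic_action r H l y"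
  shows "k = l"
proof (rule ccontr)
  assume "k \<noteq> l"
  interpret H: pair_graph H by fact
  have 1: "1 \<in> {1..r}" using k by auto
  let ?k = "shift_index r k 1" and ?l = "shift_index r l 1"
  \<comment> \<open>At index 1 the offset in \<open>shift_index\<close> cancels, so these indices
    are just \<open>k + 1\<close> and \<open>l + 1\<close>.\<close>
  have "?k \<noteq> ?l" using k l \<open>k \<noteq> l\<close> by (simp add: shift_index_def eq_nat_nat_iff)
  then have "y ?k \<times> y ?l \<subseteq> parcs H"
    using y shift_index_in[OF 1, of k] shift_index_in[OF 1, of l] unfolding in_hom_poset_iff by blast
  moreover have "x 1 \<subseteq> y ?k" "x 1 \<subseteq> y ?l"
    using le 1 unfolding le_hom_poset_iff by (metis cyclic_action_apply[OF y 1])+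
  moreover have "x 1 \<noteq> {}" using x 1 unfolding in_hom_poset_iff by blast
  \<comment> \<open>Any element of \<open>x 1\<close> lies in two entries of \<open>y\<close> that
    are completely joined to each other, and so carries a loop.\<close>
  ultimately obtain v where "(v, v) \<in> parcs H" by blast
  then show False using H.no_loops' by blast
qed

text \<open>Applying the inverse shift to \<open>cyclic_action r H k y\<close> \<le>
  \<open>x\<close> moves the translate to the other side. Both alternatives of adjacency then say
  that one tuple is below a non-trivial translate of the other.\<close>

lemma compatibility_graph_arc_cases:
  assumes "(x, y) \<in> parcs (compatibility_graph (integer_mod_group r) (hom_poset r H) (cyclic_action r H))"
    and "r \<ge> 1"
  obtains k where "0 < k" "k < int r"
    "x \<sqsubseteq>\<^bsub>hom_poset r H\<^esub> cyclic_action r H k y \<or> y \<sqsubseteq>\<^bsub>hom_poset r H\<^esub> cyclic_action r H k x"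
proof -
  obtain k where x: "x \<in> carrier (hom_poset r H)" and y: "y \<in> carrier (hom_poset r H)"
    and k: "0 < k" "k < int r"
    and le: "x \<sqsubseteq>\<^bsub>hom_poset r H\<^esub> cyclic_action r H k y \<or> cyclic_action r H k y \<sqsubseteq>\<^bsub>hom_poset r H\<^esub> x"
    using assms by (force simp: compatibility_graph_def carrier_integer_mod_group)
  have "cyclic_action r H (- k mod int r) (cyclic_action r H k y) = y"
    using y by (simp add: cyclic_action_add cyclic_action_0 mod_simps)
  then have "cyclic_action r H k y \<sqsubseteq>\<^bsub>hom_poset r H\<^esub> x \<Longrightarrow>
      y \<sqsubseteq>\<^bsub>hom_poset r H\<^esub> cyclic_action r H (- k mod int r) x"
    using cyclic_action_mono[OF cyclic_action_closed[OF y] x] by metis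
  \<comment> \<open>The inverse shift again lies strictly between 0 and \<open>r\<close>, so it can
    serve as the witness in the second alternative.\<close>
  moreover have "- k mod int r = int r - k"
    using k by (simp add: zmod_zminus1_eq_if)
  ultimately show ?thesis
    using that[of k] that[of "int r - k"] k le by auto
qed

text \<open>Totality at \<open>x = y\<close> supplies reflexivity. A new element either has the
  least element of the rest below it or is itself below that element, hence below
  everything.\<close>

lemma finite_total_preorder_has_least:
  assumes "finite S" "S \<noteq> {}"
    and "\<And>x y. x \<in> S \<Longrightarrow> y \<in> S \<Longrightarrow> R x y \<or> R y x"
    and "\<And>x y z. x \<in> S \<Longrightarrow> y \<in> S \<Longrightarrow> z \<in> S \<Longrightarrow> R x y \<Longrightarrow> R y z \<Longrightarrow> R x z"
  shows "\<exists>m\<in>S. \<forall>y\<in>S. R m y"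
  using assms
proof (induction S rule: finite_ne_induct)
  case (singleton x)
  then show ?case by blast
next
  case (insert x F)
  have "\<exists>m\<in>F. \<forall>y\<in>F. R m y"
    using insert.prems by (intro insert.IH) blast+
  then obtain m where m: "m \<in> F" "\<forall>y\<in>F. R m y" by blast
  show ?case
  proof (cases "R m x")
    case True
    then show ?thesis using m by blast
  next
    case False
    then have "R x m" "R x x" using insert.prems(1) m(1) by blast+
    then have "\<forall>y\<in>insert x F. R x y" using insert.prems(2) m by blast
    then show ?thesis by blast
  qed
qed

theorem theorem3p1:
  fixes H :: "'a pair_pre_digraph" and r :: nat
  assumes "pair_graph H"
    and "r \<ge> 2"
  shows "complete_graph_free (r + 1)
           (compatibility_graph (integer_mod_group r) (hom_poset r H) (cyclic_action r H))"
proof -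
  let ?P = "hom_poset r H" and ?\<phi> = "cyclic_action r H"
  let ?C = "compatibility_graph (integer_mod_group r) ?P ?\<phi>"
  have False
    if S: "S \<subseteq> pverts ?C" "card S = r + 1" "finite S"
      and clique: "\<forall>u\<in>S. \<forall>v\<in>S. u \<noteq> v \<longrightarrow> (u, v) \<in> parcs ?C" for S
  proof -
    have P: "x \<in> carrier ?P" if "x \<in> S" for x
      using S(1) that by (auto simp: compatibility_graph_def)
    \<comment> \<open>Unlike adjacency, \<open>R\<close> admits the shift 0: this makes it
      reflexive, and also transitive, since two non-trivial shifts may cancel.\<close>
    define R where "R x y \<longleftrightarrow> (\<exists>k\<in>{0..<int r}. x \<sqsubseteq>\<^bsub>?P\<^esub> ?\<phi> k y)" for x y
    have "\<exists>m\<in>S. \<forall>y\<in>S. R m y"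
    proof (rule finite_total_preorder_has_least)
      show "finite S" "S \<noteq> {}" using S by auto
      show "R x y \<or> R y x" if xy: "x \<in> S" "y \<in> S" for x y
      proof (cases "x = y")
        case True
        have "x \<sqsubseteq>\<^bsub>?P\<^esub> ?\<phi> 0 x"
          using P[OF xy(1)] by (simp add: cyclic_action_0 le_hom_poset_iff)
        then show ?thesis using True assms(2) unfolding R_def by force
      next
        case False
        then have "(x, y) \<in> parcs ?C" using clique xy by blast
        then obtain k where "0 < k" "k < int r" "x \<sqsubseteq>\<^bsub>?P\<^esub> ?\<phi> k y \<or> y \<sqsubseteq>\<^bsub>?P\<^esub> ?\<phi> k x"
          using assms(2) by (elim compatibility_graph_arc_cases) auto
        then show ?thesis unfolding R_def by force
      qed
      show "R x z" if xyz: "x \<in> S" "y \<in> S" "z \<in> S" "R x y" "R y z" for x y z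
      proof -
        obtain k l where "x \<sqsubseteq>\<^bsub>?P\<^esub> ?\<phi> k y" "y \<sqsubseteq>\<^bsub>?P\<^esub> ?\<phi> l z"
          using xyz(4,5) unfolding R_def by blast
        then have "x \<sqsubseteq>\<^bsub>?P\<^esub> ?\<phi> ((k + l) mod int r) z"
          using P xyz(2,3) by (blast intro: le_cyclic_action_trans)
        moreover have "(k + l) mod int r \<in> {0..<int r}" using assms(2) by simp
        ultimately show ?thesis unfolding R_def by blast
      qed
    qed
    \<comment> \<open>The function \<open>h\<close> chooses, for each \<open>y\<close> in
      \<open>S\<close>, a shift witnessing \<open>R m y\<close>.\<close>
    then obtain m h where m: "m \<in> S"
      and h: "\<And>y. y \<in> S \<Longrightarrow> h y \<in> {0..<int r} \<and> m \<sqsubseteq>\<^bsub>?P\<^esub> ?\<phi> (h y) y"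
      unfolding R_def by metis
    have no_arc: "\<not> x \<sqsubseteq>\<^bsub>?P\<^esub> ?\<phi> k y"
      if "x \<in> S" "y \<in> S" "h x = h y" "0 < k" "k < int r" for x y k
    proof
      assume "x \<sqsubseteq>\<^bsub>?P\<^esub> ?\<phi> k y"
      then have "m \<sqsubseteq>\<^bsub>?P\<^esub> ?\<phi> ((h y + k) mod int r) y"
        using h[of x] P that by (metis le_cyclic_action_trans)
      \<comment> \<open>Both sides are reduced shifts that put \<open>m\<close> below a translate of
        \<open>y\<close>, so they coincide.\<close>
      then have "h y = (h y + k) mod int r"
        using le_cyclic_action_unique[OF assms(1) P[OF m] P[OF that(2)]] h[OF that(2)] assms(2)
        by simp
      then have "h y mod int r = (h y + k) mod int r" by (metis mod_mod_trivial)
      then have "int r dvd k"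
        by (metis add_diff_cancel_left' dvd_minus_iff minus_diff_eq mod_eq_dvd_iff)
      then show False using that(4,5) zdvd_not_zless by blast
    qed
    have "inj_on h S"
    proof (rule inj_onI, rule ccontr)
      fix x y assume xy: "x \<in> S" "y \<in> S" "h x = h y" "x \<noteq> y"
      then have "(x, y) \<in> parcs ?C" using clique by blast
      then obtain k where "0 < k" "k < int r" "x \<sqsubseteq>\<^bsub>?P\<^esub> ?\<phi> k y \<or> y \<sqsubseteq>\<^bsub>?P\<^esub> ?\<phi> k x"
        using assms(2) by (elim compatibility_graph_arc_cases) auto
      \<comment> \<open>The condition \<open>h x = h y\<close> is symmetric, so
        \<open>no_arc\<close> refutes either direction of the comparison.\<close>
      then show False using no_arc xy by metis
    qed
    \<comment> \<open>Pigeonhole: \<open>r + 1\<close> clique elements would need distinct values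
      among only \<open>r\<close> shifts.\<close>
    then have "card S \<le> card {0..<int r}"
      using h by (intro card_inj_on_le) auto
    then show False using S(2) by simp
  qed
  then show ?thesis
    unfolding complete_graph_free_iff_no_clique[OF pair_graph_compatibility_graph_hom_poset[OF assms]]
    by blast
qed

end
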